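(* Let $\Omega\subset\mathbb{R}^d$ be convex and compact with non-negligible interior. Let $\mu,\nu\in\mathcal{P}(\Omega)$ with $\mu,\nu\ll\mathcal{L}_d$, and suppose that $(\lambda_n)_{n=0}^\infty$ is a sequence of positive step sizes with $$\sum_{n=0}^\infty\lambda_n=+\infty .$$ Given $\mu_0:=\mu$, for each $n\ge0$ define $$\mu_{n+1}:=\operatorname*{arg\,min}_{\rho\in\mathcal{P}(\Omega)}\ \frac12W_2^2(\rho,\mu_n)+\lambda_nW_1(\rho,\nu).$$ Then $$\lim_{n\to\infty}W_1(\mu_n,\nu)=0 .$$
   Context: $\mathcal{P}(\Omega)$ is the set of Borel probability measures on $\Omega$, $\mathcal{L}_d$ is Lebesgue measure, and $W_p$ is the Wasserstein $p$ distance for the Euclidean distance. The sequence is well defined: if $\mu_n,\nu\ll\mathcal{L}_d$, the minimizer $\mu_{n+1}$ exists, is unique, and is again absolutely continuous with respect to $\mathcal{L}_d$. *)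

theory Defs
  imports "HOL-Probability.Probability"
begin

text \<open>
  A Borel probability measure on a Borel set \<open>\<Omega>\<close> is represented by a Borel probability
  measure on the ambient space that gives \<open>\<Omega>\<close> full mass. This makes absolute continuity
  with respect to \<^const>\<open>lborel\<close> directly expressible.
\<close>

definition prob_measures_on :: "'a::euclidean_space set \<Rightarrow> 'a measure set" where
  "prob_measures_on \<Omega> = {\<mu>. prob_space \<mu> \<and> sets \<mu> = sets borel \<and> emeasure \<mu> \<Omega> = 1}"

definition couplings ::
    "'a::euclidean_space measure \<Rightarrow> 'a measure \<Rightarrow> ('a \<times> 'a) measure set" where
  "couplings \<mu> \<nu> =
     {\<gamma>. sets \<gamma> = sets (borel \<Otimes>\<^sub>M borel) \<and> distr \<gamma> borel fst = \<mu> \<and> distr \<gamma> borel snd = \<nu>}"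

definition transport_cost ::
    "real \<Rightarrow> 'a::euclidean_space measure \<Rightarrow> 'a measure \<Rightarrow> ennreal" where
  "transport_cost p \<mu> \<nu> =
     (INF \<gamma>\<in>couplings \<mu> \<nu>. \<integral>\<^sup>+ z. ennreal (dist (fst z) (snd z) powr p) \<partial>\<gamma>)"

text \<open>
  The real-valued distance is meaningful only when the transport cost is finite
  (\<^const>\<open>enn2real\<close> sends \<open>\<infinity>\<close> to \<open>0\<close>); this holds for probability measures on a bounded set,
  where the product coupling has finite cost.
\<close>

definition wasserstein ::
    "real \<Rightarrow> 'a::euclidean_space measure \<Rightarrow> 'a measure \<Rightarrow> real" where
  "wasserstein p \<mu> \<nu> = enn2real (transport_cost p \<mu> \<nu>) powr (1 / p)"

end

theory Submission
  imports Defs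
begin

text \<open>
  The idea is to compare \<open>\<mu>\<^sub>n\<^sub>+\<^sub>1\<close> with measures obtained by moving \<open>\<mu>\<^sub>n\<close> part of the way towards
  \<open>\<nu>\<close>. Let \<open>\<gamma>\<close> couple \<open>\<mu>\<^sub>n\<close> with \<open>\<nu>\<close>, write \<open>R = \<integral> |x - y| d\<gamma>\<close>, let \<open>D > 0\<close> bound the distances
  in \<open>\<Omega>\<close>, and let \<open>\<rho>\<close> be the law of \<open>(1 - s) x + s y\<close> under \<open>\<gamma>\<close>, which lives on \<open>\<Omega>\<close> by convexity.
  The pairs \<open>((1 - s) x + s y, x)\<close> and \<open>((1 - s) x + s y, y)\<close> couple \<open>\<rho>\<close> with \<open>\<mu>\<^sub>n\<close> and with \<open>\<nu>\<close>, so
  \<open>W\<^sub>2\<^sup>2(\<rho>, \<mu>\<^sub>n) \<le> s\<^sup>2 \<integral> |x - y|\<^sup>2 d\<gamma> \<le> s\<^sup>2 D R\<close> and \<open>W\<^sub>1(\<rho>, \<nu>) \<le> (1 - s) R\<close>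
  (lemma \<open>interpolant_costs\<close>).

  Taking \<open>s = min (\<lambda>\<^sub>n / D) 1\<close> makes the quadratic term at most \<open>\<lambda>\<^sub>n s R / 2\<close>, half of what is
  gained in the \<open>W\<^sub>1\<close> term. Minimality of \<open>\<mu>\<^sub>n\<^sub>+\<^sub>1\<close> and the infimum over \<open>\<gamma>\<close> then give the
  contraction \<open>W\<^sub>1(\<mu>\<^sub>n\<^sub>+\<^sub>1, \<nu>) \<le> (1 - s\<^sub>n / 2) W\<^sub>1(\<mu>\<^sub>n, \<nu>)\<close> (lemma \<open>proximal_step_contraction\<close>).
  Truncating the terms of a divergent series at a positive level leaves it divergent, so
  \<open>\<Sum> s\<^sub>n = \<infinity>\<close>. A positive limit \<open>L\<close> of the decreasing distances would force a total decrease of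
  at least \<open>\<Sum> L s\<^sub>n / 2 = \<infinity>\<close>, which is impossible (lemma \<open>contraction_tendsto_zero\<close>).
\<close>

section \<open>Couplings and transport costs\<close>

lemma coupling_measurable:
  assumes "\<gamma> \<in> couplings \<mu> \<nu>"
  shows "fst \<in> \<gamma> \<rightarrow>\<^sub>M borel" and "snd \<in> \<gamma> \<rightarrow>\<^sub>M borel"
proof -
  have [measurable_cong]: "sets \<gamma> = sets (borel \<Otimes>\<^sub>M borel)"
    using assms by (simp add: couplings_def)
  show "fst \<in> \<gamma> \<rightarrow>\<^sub>M borel" "snd \<in> \<gamma> \<rightarrow>\<^sub>M borel"
    by measurable
qed

lemma coupling_prob_space:
  assumes "\<gamma> \<in> couplings \<mu> \<nu>" "prob_space \<mu>"
  shows "prob_space \<gamma>"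
  using assms prob_space_distrD[OF coupling_measurable(1)[OF assms(1)]]
  by (simp add: couplings_def)

lemma AE_prob_measures_on:
  assumes "\<mu> \<in> prob_measures_on \<Omega>" "closed \<Omega>"
  shows "AE x in \<mu>. x \<in> \<Omega>"
proof -
  interpret prob_space \<mu>
    using assms by (simp add: prob_measures_on_def)
  have "\<Omega> \<in> sets \<mu>" "emeasure \<mu> \<Omega> = 1"
    using assms by (auto simp: prob_measures_on_def)
  then show ?thesis
    by (simp add: AE_in_set_eq_1 emeasure_eq_measure)
qed

lemma AE_coupling:
  assumes \<gamma>: "\<gamma> \<in> couplings \<mu> \<nu>"
    and \<mu>: "\<mu> \<in> prob_measures_on \<Omega>" and \<nu>: "\<nu> \<in> prob_measures_on \<Omega>" and "closed \<Omega>"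
  shows "AE z in \<gamma>. fst z \<in> \<Omega> \<and> snd z \<in> \<Omega>"
proof -
  note [measurable] = coupling_measurable[OF \<gamma>]
  have "AE x in distr \<gamma> borel fst. x \<in> \<Omega>" "AE x in distr \<gamma> borel snd. x \<in> \<Omega>"
    using AE_prob_measures_on[OF \<mu> \<open>closed \<Omega>\<close>] AE_prob_measures_on[OF \<nu> \<open>closed \<Omega>\<close>] \<gamma>
    unfolding couplings_def by blast+
  then show ?thesis
    using \<open>closed \<Omega>\<close> by (simp add: AE_distr_iff AE_conj_iff)
qed

lemma transport_cost_distr_le:
  fixes f g :: "'b \<Rightarrow> 'a::euclidean_space"
  assumes [measurable]: "f \<in> M \<rightarrow>\<^sub>M borel" "g \<in> M \<rightarrow>\<^sub>M borel"
  shows "transport_cost p (distr M borel f) (distr M borel g)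
    \<le> (\<integral>\<^sup>+ z. ennreal (dist (f z) (g z) powr p) \<partial>M)"
proof -
  let ?\<gamma> = "distr M (borel \<Otimes>\<^sub>M borel) (\<lambda>z. (f z, g z))"
  have "?\<gamma> \<in> couplings (distr M borel f) (distr M borel g)"
    by (simp add: couplings_def distr_distr comp_def)
  then have "transport_cost p (distr M borel f) (distr M borel g)
      \<le> (\<integral>\<^sup>+ z. ennreal (dist (fst z) (snd z) powr p) \<partial>?\<gamma>)"
    unfolding transport_cost_def by (rule INF_lower)
  also have "\<dots> = (\<integral>\<^sup>+ z. ennreal (dist (f z) (g z) powr p) \<partial>M)"
    by (simp add: nn_integral_distr)
  finally show ?thesis .
qed

lemma product_coupling:
  assumes \<mu>: "\<mu> \<in> prob_measures_on \<Omega>" and \<nu>: "\<nu> \<in> prob_measures_on \<Omega>"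
  shows "\<mu> \<Otimes>\<^sub>M \<nu> \<in> couplings \<mu> \<nu>"
proof -
  interpret M: prob_space \<mu> using \<mu> by (simp add: prob_measures_on_def)
  interpret N: prob_space \<nu> using \<nu> by (simp add: prob_measures_on_def)
  interpret P: pair_prob_space \<mu> \<nu> ..
  have [measurable_cong]: "sets \<mu> = sets borel" "sets \<nu> = sets borel"
    using \<mu> \<nu> by (simp_all add: prob_measures_on_def)
  have fst: "distr (\<mu> \<Otimes>\<^sub>M \<nu>) \<mu> fst = \<mu>"
    by (rule N.distr_pair_fst)
  have "distr (\<mu> \<Otimes>\<^sub>M \<nu>) \<nu> snd = distr (distr (\<nu> \<Otimes>\<^sub>M \<mu>) (\<mu> \<Otimes>\<^sub>M \<nu>) (\<lambda>(x, y). (y, x))) \<nu> snd"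
    using P.distr_pair_swap by simp
  also have "\<dots> = distr (\<nu> \<Otimes>\<^sub>M \<mu>) \<nu> fst"
    by (simp add: distr_distr comp_def case_prod_beta)
  also have "\<dots> = \<nu>"
    by (rule M.distr_pair_fst)
  finally have snd: "distr (\<mu> \<Otimes>\<^sub>M \<nu>) \<nu> snd = \<nu>" .
  have "distr (\<mu> \<Otimes>\<^sub>M \<nu>) borel fst = \<mu>" "distr (\<mu> \<Otimes>\<^sub>M \<nu>) borel snd = \<nu>"
    using fst snd distr_cong[of "\<mu> \<Otimes>\<^sub>M \<nu>" "\<mu> \<Otimes>\<^sub>M \<nu>" borel \<mu> fst fst]
      distr_cong[of "\<mu> \<Otimes>\<^sub>M \<nu>" "\<mu> \<Otimes>\<^sub>M \<nu>" borel \<nu> snd snd]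
    by (simp_all add: \<open>sets \<mu> = sets borel\<close> \<open>sets \<nu> = sets borel\<close>)
  moreover have "sets (\<mu> \<Otimes>\<^sub>M \<nu>) = sets (borel \<Otimes>\<^sub>M borel)"
    by (rule sets_pair_measure_cong) fact+
  ultimately show ?thesis
    by (simp add: couplings_def)
qed

lemma coupling_cost_le:
  assumes "\<gamma> \<in> couplings \<mu> \<nu>" "\<mu> \<in> prob_measures_on \<Omega>" "\<nu> \<in> prob_measures_on \<Omega>" "closed \<Omega>"
    and D: "\<And>x y. x \<in> \<Omega> \<Longrightarrow> y \<in> \<Omega> \<Longrightarrow> dist x y \<le> D"
  shows "(\<integral>\<^sup>+ z. ennreal (dist (fst z) (snd z)) \<partial>\<gamma>) \<le> ennreal D"
proof -
  interpret prob_space \<gamma>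
    using assms coupling_prob_space by (auto simp: prob_measures_on_def)
  have "(\<integral>\<^sup>+ z. ennreal (dist (fst z) (snd z)) \<partial>\<gamma>) \<le> (\<integral>\<^sup>+ z. ennreal D \<partial>\<gamma>)"
  proof (rule nn_integral_mono_AE)
    show "AE z in \<gamma>. ennreal (dist (fst z) (snd z)) \<le> ennreal D"
      using AE_coupling[OF assms(1-4)] by eventually_elim (simp add: D ennreal_leI)
  qed
  then show ?thesis
    by (simp add: emeasure_space_1)
qed

lemma transport_cost_1:
  "transport_cost 1 \<mu> \<nu> = (INF \<gamma>\<in>couplings \<mu> \<nu>. \<integral>\<^sup>+ z. ennreal (dist (fst z) (snd z)) \<partial>\<gamma>)"
  by (simp add: transport_cost_def)

lemma wasserstein_1: "wasserstein 1 \<mu> \<nu> = enn2real (transport_cost 1 \<mu> \<nu>)"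
  by (simp add: wasserstein_def)

lemma wasserstein_2_squared: "(wasserstein 2 \<mu> \<nu>)\<^sup>2 = enn2real (transport_cost 2 \<mu> \<nu>)"
  by (simp add: wasserstein_def powr_half_sqrt)

lemma wasserstein_nonneg: "wasserstein p \<mu> \<nu> \<ge> 0"
  by (simp add: wasserstein_def)

text \<open>
  The contraction estimate is linear in the cost of the coupling from which it starts. It is
  proved for couplings whose cost is within \<open>\<epsilon>\<close> of \<open>W\<^sub>1\<close>, for every \<open>\<epsilon> > 0\<close>.
\<close>

lemma nearly_optimal_coupling:
  assumes \<mu>: "\<mu> \<in> prob_measures_on \<Omega>" and \<nu>: "\<nu> \<in> prob_measures_on \<Omega>"
    and "closed \<Omega>" and D: "\<And>x y. x \<in> \<Omega> \<Longrightarrow> y \<in> \<Omega> \<Longrightarrow> dist x y \<le> D"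
    and "\<epsilon> > 0"
  obtains \<gamma> where "\<gamma> \<in> couplings \<mu> \<nu>"
    and "enn2real (\<integral>\<^sup>+ z. ennreal (dist (fst z) (snd z)) \<partial>\<gamma>) < wasserstein 1 \<mu> \<nu> + \<epsilon>"
proof -
  \<comment> \<open>The product coupling makes the infimum finite, so that its real value carries no loss.\<close>
  have "transport_cost 1 \<mu> \<nu> \<le> ennreal D"
    unfolding transport_cost_1 using product_coupling[OF \<mu> \<nu>]
  proof (rule INF_lower2)
    show "(\<integral>\<^sup>+ z. ennreal (dist (fst z) (snd z)) \<partial>(\<mu> \<Otimes>\<^sub>M \<nu>)) \<le> ennreal D"
      using product_coupling[OF \<mu> \<nu>] \<mu> \<nu> \<open>closed \<Omega>\<close> D by (rule coupling_cost_le)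
  qed
  then have fin: "transport_cost 1 \<mu> \<nu> < \<top>"
    by (simp add: le_less_trans)
  then have W: "transport_cost 1 \<mu> \<nu> = ennreal (wasserstein 1 \<mu> \<nu>)"
    by (simp add: wasserstein_1)
  have "transport_cost 1 \<mu> \<nu> < ennreal (wasserstein 1 \<mu> \<nu> + \<epsilon>)"
    unfolding W using \<open>\<epsilon> > 0\<close> wasserstein_nonneg[of 1 \<mu> \<nu>] by (intro ennreal_lessI) auto
  then obtain \<gamma> where \<gamma>: "\<gamma> \<in> couplings \<mu> \<nu>"
    and less: "(\<integral>\<^sup>+ z. ennreal (dist (fst z) (snd z)) \<partial>\<gamma>) < ennreal (wasserstein 1 \<mu> \<nu> + \<epsilon>)"
    unfolding transport_cost_1 INF_less_iff by blast
  have "enn2real (\<integral>\<^sup>+ z. ennreal (dist (fst z) (snd z)) \<partial>\<gamma>) < wasserstein 1 \<mu> \<nu> + \<epsilon>"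
    using less \<open>\<epsilon> > 0\<close> wasserstein_nonneg[of 1 \<mu> \<nu>]
    by (cases "\<integral>\<^sup>+ z. ennreal (dist (fst z) (snd z)) \<partial>\<gamma>") (auto simp: ennreal_less_iff simp del: ennreal_plus)
  with \<gamma> show ?thesis
    by (rule that)
qed

section \<open>Interpolating along a coupling\<close>

text \<open>
  For a \<open>\<gamma>\<close> that is optimal for the quadratic cost this is McCann's displacement interpolation between the marginals.
\<close>

definition interpolant :: "real \<Rightarrow> ('a::euclidean_space \<times> 'a) measure \<Rightarrow> 'a measure" where
  "interpolant s \<gamma> = distr \<gamma> borel (\<lambda>z. (1 - s) *\<^sub>R fst z + s *\<^sub>R snd z)"

lemma interpolant_in_prob_measures_on:
  assumes \<gamma>: "\<gamma> \<in> couplings \<mu> \<nu>"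
    and \<mu>: "\<mu> \<in> prob_measures_on \<Omega>" and \<nu>: "\<nu> \<in> prob_measures_on \<Omega>"
    and "convex \<Omega>" "closed \<Omega>" and "0 \<le> s" "s \<le> 1"
  shows "interpolant s \<gamma> \<in> prob_measures_on \<Omega>"
proof -
  note [measurable] = coupling_measurable[OF \<gamma>]
  interpret G: prob_space \<gamma>
    using \<gamma> \<mu> coupling_prob_space by (auto simp: prob_measures_on_def)
  interpret I: prob_space "interpolant s \<gamma>"
    unfolding interpolant_def by (rule G.prob_space_distr) measurable
  have "AE z in \<gamma>. (1 - s) *\<^sub>R fst z + s *\<^sub>R snd z \<in> \<Omega>"
    using AE_coupling[OF \<gamma> \<mu> \<nu> \<open>closed \<Omega>\<close>]
    by eventually_elim (use assms in \<open>auto intro!: convexD\<close>)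
  then have "AE x in interpolant s \<gamma>. x \<in> \<Omega>"
    unfolding interpolant_def using \<open>closed \<Omega>\<close> by (subst AE_distr_iff) auto
  moreover have "\<Omega> \<in> sets (interpolant s \<gamma>)"
    using \<open>closed \<Omega>\<close> by (simp add: interpolant_def)
  ultimately have "emeasure (interpolant s \<gamma>) \<Omega> = 1"
    by (simp add: I.AE_in_set_eq_1 I.emeasure_eq_measure)
  then show ?thesis
    by (simp add: prob_measures_on_def I.prob_space_axioms) (simp add: interpolant_def)
qed

text \<open>
  Both bounds come from transporting along the straight segments from \<open>x\<close> to \<open>y\<close>: the
  interpolated point lies at distance \<open>s |x - y|\<close> from \<open>x\<close> and \<open>(1 - s) |x - y|\<close> from \<open>y\<close>. The
  quadratic cost is expressed through the linear one by \<open>|x - y|\<^sup>2 \<le> D |x - y|\<close>, which puts both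
  terms of the proximal functional on the same scale.
\<close>

lemma interpolant_costs:
  fixes \<mu> \<nu> :: "'a::euclidean_space measure"
  assumes \<gamma>: "\<gamma> \<in> couplings \<mu> \<nu>"
    and \<mu>: "\<mu> \<in> prob_measures_on \<Omega>" and \<nu>: "\<nu> \<in> prob_measures_on \<Omega>" and "closed \<Omega>"
    and D: "\<And>x y. x \<in> \<Omega> \<Longrightarrow> y \<in> \<Omega> \<Longrightarrow> dist x y \<le> D" and "0 \<le> D"
    and "0 \<le> s" "s \<le> 1"
  defines "R \<equiv> enn2real (\<integral>\<^sup>+ z. ennreal (dist (fst z) (snd z)) \<partial>\<gamma>)"
  shows "(wasserstein 2 (interpolant s \<gamma>) \<mu>)\<^sup>2 \<le> s\<^sup>2 * D * R"
    and "wasserstein 1 (interpolant s \<gamma>) \<nu> \<le> (1 - s) * R"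
proof -
  note [measurable] = coupling_measurable[OF \<gamma>]
  let ?h = "\<lambda>z :: 'a \<times> 'a. (1 - s) *\<^sub>R fst z + s *\<^sub>R snd z"
  have marg: "\<mu> = distr \<gamma> borel fst" "\<nu> = distr \<gamma> borel snd"
    using \<gamma> by (simp_all add: couplings_def)
  have "R \<ge> 0" by (simp add: R_def)
  have R: "(\<integral>\<^sup>+ z. ennreal (dist (fst z) (snd z)) \<partial>\<gamma>) = ennreal R"
    using coupling_cost_le[OF \<gamma> \<mu> \<nu> \<open>closed \<Omega>\<close> D] unfolding R_def
    by (metis ennreal_enn2real ennreal_less_top le_less_trans)
  have "?h z - fst z = s *\<^sub>R (snd z - fst z)" for z
    by (simp add: algebra_simps)
  then have dist_fst: "dist (?h z) (fst z) = s * dist (fst z) (snd z)" for z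
    using \<open>0 \<le> s\<close> by (simp only: dist_norm norm_scaleR abs_of_nonneg norm_minus_commute[of "fst z" "snd z"])
  have "?h z - snd z = (1 - s) *\<^sub>R (fst z - snd z)" for z
    by (simp add: algebra_simps)
  then have dist_snd: "dist (?h z) (snd z) = (1 - s) * dist (fst z) (snd z)" for z
    using \<open>s \<le> 1\<close> by (simp add: dist_norm)

  have "transport_cost 2 (interpolant s \<gamma>) \<mu>
      \<le> (\<integral>\<^sup>+ z. ennreal (dist (?h z) (fst z) powr 2) \<partial>\<gamma>)"
    unfolding interpolant_def by (subst marg(1), rule transport_cost_distr_le) measurable
  also have "\<dots> \<le> (\<integral>\<^sup>+ z. ennreal (s\<^sup>2 * D) * ennreal (dist (fst z) (snd z)) \<partial>\<gamma>)"
  proof (rule nn_integral_mono_AE)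
    show "AE z in \<gamma>. ennreal (dist (?h z) (fst z) powr 2)
        \<le> ennreal (s\<^sup>2 * D) * ennreal (dist (fst z) (snd z))"
      using AE_coupling[OF \<gamma> \<mu> \<nu> \<open>closed \<Omega>\<close>]
    proof eventually_elim
      case (elim z)
      then have "dist (fst z) (snd z) * dist (fst z) (snd z) \<le> D * dist (fst z) (snd z)"
        by (intro mult_right_mono D) auto
      then have "s\<^sup>2 * (dist (fst z) (snd z) * dist (fst z) (snd z))
          \<le> s\<^sup>2 * (D * dist (fst z) (snd z))"
        by (rule mult_left_mono) simp
      then have "dist (?h z) (fst z) powr 2 \<le> s\<^sup>2 * D * dist (fst z) (snd z)"
        unfolding dist_fst using \<open>0 \<le> s\<close> by (simp add: power2_eq_square mult_ac)
      then show ?case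
        using \<open>0 \<le> D\<close> by (simp add: ennreal_mult[symmetric] ennreal_leI)
    qed
  qed
  also have "\<dots> = ennreal (s\<^sup>2 * D * R)"
    using \<open>0 \<le> D\<close> \<open>R \<ge> 0\<close> by (simp add: nn_integral_cmult R ennreal_mult)
  finally show "(wasserstein 2 (interpolant s \<gamma>) \<mu>)\<^sup>2 \<le> s\<^sup>2 * D * R"
    unfolding wasserstein_2_squared using \<open>0 \<le> D\<close> \<open>R \<ge> 0\<close> by (intro enn2real_leI) auto

  have "transport_cost 1 (interpolant s \<gamma>) \<nu>
      \<le> (\<integral>\<^sup>+ z. ennreal (dist (?h z) (snd z) powr 1) \<partial>\<gamma>)"
    unfolding interpolant_def by (subst marg(2), rule transport_cost_distr_le) measurable
  also have "\<dots> = (\<integral>\<^sup>+ z. ennreal (1 - s) * ennreal (dist (fst z) (snd z)) \<partial>\<gamma>)"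
    unfolding dist_snd using \<open>s \<le> 1\<close> by (simp add: ennreal_mult)
  also have "\<dots> = ennreal ((1 - s) * R)"
    using \<open>s \<le> 1\<close> \<open>R \<ge> 0\<close> by (simp add: nn_integral_cmult R ennreal_mult)
  finally show "wasserstein 1 (interpolant s \<gamma>) \<nu> \<le> (1 - s) * R"
    unfolding wasserstein_1 using \<open>s \<le> 1\<close> \<open>R \<ge> 0\<close> by (intro enn2real_leI) auto
qed

section \<open>Contraction in one proximal step\<close>

lemma proximal_step_contraction:
  fixes \<Omega> :: "'a::euclidean_space set"
  assumes "convex \<Omega>" "closed \<Omega>"
    and D: "\<And>x y. x \<in> \<Omega> \<Longrightarrow> y \<in> \<Omega> \<Longrightarrow> dist x y \<le> D" and "D > 0"
    and \<mu>: "\<mu> \<in> prob_measures_on \<Omega>" and \<nu>: "\<nu> \<in> prob_measures_on \<Omega>"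
    and "t > 0"
    and min: "is_arg_min (\<lambda>\<rho>. 1 / 2 * (wasserstein 2 \<rho> \<mu>)\<^sup>2 + t * wasserstein 1 \<rho> \<nu>)
           (\<lambda>\<rho>. \<rho> \<in> prob_measures_on \<Omega>) \<mu>'"
  shows "wasserstein 1 \<mu>' \<nu> \<le> (1 - min (t / D) 1 / 2) * wasserstein 1 \<mu> \<nu>"
proof (rule field_le_epsilon)
  fix \<epsilon> :: real
  assume "\<epsilon> > 0"
  define s where "s = min (t / D) 1"
  have s: "0 \<le> s" "s \<le> 1" "s * D \<le> t"
    using \<open>D > 0\<close> \<open>t > 0\<close> by (auto simp: s_def min_def field_simps)
  obtain \<gamma> where \<gamma>: "\<gamma> \<in> couplings \<mu> \<nu>"
    and near: "enn2real (\<integral>\<^sup>+ z. ennreal (dist (fst z) (snd z)) \<partial>\<gamma>) < wasserstein 1 \<mu> \<nu> + \<epsilon>"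
    using nearly_optimal_coupling[OF \<mu> \<nu> \<open>closed \<Omega>\<close> D \<open>\<epsilon> > 0\<close>] by blast
  define R where "R = enn2real (\<integral>\<^sup>+ z. ennreal (dist (fst z) (snd z)) \<partial>\<gamma>)"
  have "R \<ge> 0" by (simp add: R_def)
  let ?\<rho> = "interpolant s \<gamma>"
  have W2: "(wasserstein 2 ?\<rho> \<mu>)\<^sup>2 \<le> s\<^sup>2 * D * R"
    and W1: "wasserstein 1 ?\<rho> \<nu> \<le> (1 - s) * R"
    using interpolant_costs[OF \<gamma> \<mu> \<nu> \<open>closed \<Omega>\<close> D _ s(1,2)] \<open>D > 0\<close> by (auto simp: R_def)
  have "t * wasserstein 1 \<mu>' \<nu> \<le> 1 / 2 * (wasserstein 2 \<mu>' \<mu>)\<^sup>2 + t * wasserstein 1 \<mu>' \<nu>"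
    by simp
  also have "\<dots> \<le> 1 / 2 * (wasserstein 2 ?\<rho> \<mu>)\<^sup>2 + t * wasserstein 1 ?\<rho> \<nu>"
    using min interpolant_in_prob_measures_on[OF \<gamma> \<mu> \<nu> \<open>convex \<Omega>\<close> \<open>closed \<Omega>\<close> s(1,2)]
    unfolding is_arg_min_linorder by blast
  also have "\<dots> \<le> 1 / 2 * (s * t * R) + t * ((1 - s) * R)"
  proof (intro add_mono mult_left_mono W1)
    have "s\<^sup>2 * D * R = s * R * (s * D)"
      by (simp add: power2_eq_square)
    also have "\<dots> \<le> s * R * t"
      using s \<open>R \<ge> 0\<close> by (intro mult_left_mono) auto
    finally show "(wasserstein 2 ?\<rho> \<mu>)\<^sup>2 \<le> s * t * R"
      using W2 by (simp add: mult_ac)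
  qed (use \<open>t > 0\<close> in auto)
  also have "\<dots> = t * ((1 - s / 2) * R)"
    by (simp add: field_simps)
  finally have "wasserstein 1 \<mu>' \<nu> \<le> (1 - s / 2) * R"
    using \<open>t > 0\<close> by simp
  also have "\<dots> \<le> (1 - s / 2) * (wasserstein 1 \<mu> \<nu> + \<epsilon>)"
    using near s by (intro mult_left_mono) (auto simp: R_def)
  also have "\<dots> \<le> (1 - s / 2) * wasserstein 1 \<mu> \<nu> + \<epsilon>"
    using s \<open>\<epsilon> > 0\<close> by (simp add: algebra_simps)
  finally show "wasserstein 1 \<mu>' \<nu> \<le> (1 - min (t / D) 1 / 2) * wasserstein 1 \<mu> \<nu> + \<epsilon>"
    by (simp add: s_def)
qed

section \<open>Iterating the contraction\<close>

text \<open>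
  If the truncated series converged, its terms would tend to \<open>0\<close>, so that the truncation is
  eventually inactive and the original series converges as well.
\<close>

lemma summable_of_summable_min:
  fixes a :: "nat \<Rightarrow> real"
  assumes "summable (\<lambda>n. min (a n) c)" "c > 0"
  shows "summable a"
proof -
  have "(\<lambda>n. min (a n) c) \<longlonglongrightarrow> 0"
    by (rule summable_LIMSEQ_zero) fact
  then have "eventually (\<lambda>n. min (a n) c < c) sequentially"
    using \<open>c > 0\<close> by (rule order_tendstoD)
  then have "eventually (\<lambda>n. min (a n) c = a n) sequentially"
    by eventually_elim (auto simp: min_def split: if_splits)
  from summable_cong[OF this] show ?thesis
    using assms(1) by simp
qed

text \<open>
  The sequence decreases to some limit \<open>L \<ge> 0\<close>, and each step lowers it by at least \<open>L s n\<close>.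
  The total decrease is finite, so \<open>L > 0\<close> would make \<open>s\<close> summable.
\<close>

lemma contraction_tendsto_zero:
  fixes w s :: "nat \<Rightarrow> real"
  assumes w: "\<And>n. 0 \<le> w n" and s: "\<And>n. 0 \<le> s n"
    and step: "\<And>n. w (Suc n) \<le> (1 - s n) * w n"
    and "\<not> summable s"
  shows "w \<longlonglongrightarrow> 0"
proof -
  have "decseq w"
  proof (rule decseq_SucI)
    fix n
    have "0 \<le> s n * w n"
      using w s by simp
    then show "w (Suc n) \<le> w n"
      using step[of n] by (simp add: algebra_simps)
  qed
  then obtain L where L: "w \<longlonglongrightarrow> L" and L_le: "\<And>n. L \<le> w n"
    using decseq_convergent[of w 0] w by blast
  have "L \<ge> 0"
    using L w by (intro LIMSEQ_le_const) auto
  have "L = 0"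
  proof (rule ccontr)
    assume "L \<noteq> 0"
    with \<open>L \<ge> 0\<close> have "L > 0" by simp
    have decrease: "s n * L \<le> w n - w (Suc n)" for n
    proof -
      have "s n * L \<le> s n * w n"
        using s L_le by (intro mult_left_mono)
      then show ?thesis
        using step[of n] by (simp add: algebra_simps)
    qed
    have "(\<Sum>n<N. s n * L) \<le> w 0" for N
    proof -
      have "(\<Sum>n<N. s n * L) \<le> (\<Sum>n<N. w n - w (Suc n))"
        by (intro sum_mono decrease)
      also have "\<dots> = w 0 - w N"
        by (rule sum_lessThan_telescope')
      finally show ?thesis
        using w[of N] by simp
    qed
    then have "summable (\<lambda>n. s n * L)"
      using s \<open>L > 0\<close> by (intro summableI_nonneg_bounded[where x = "w 0"]) auto
    then show False
      using \<open>\<not> summable s\<close> \<open>L > 0\<close> summable_cmult_iff[of L s] by (simp add: mult.commute)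
  qed
  with L show ?thesis by simp
qed

theorem proposition1p8:
  fixes \<Omega> :: "'a::euclidean_space set"
    and \<mu> \<nu> :: "'a measure"
    and lam :: "nat \<Rightarrow> real"
    and \<mu>s :: "nat \<Rightarrow> 'a measure"
  assumes "convex \<Omega>" and "compact \<Omega>" and "\<not> negligible (interior \<Omega>)"
    and "\<mu> \<in> prob_measures_on \<Omega>" and "\<nu> \<in> prob_measures_on \<Omega>"
    and "absolutely_continuous lborel \<mu>" and "absolutely_continuous lborel \<nu>"
    and "\<And>n. lam n > 0"
    and "filterlim (\<lambda>N. \<Sum>n<N. lam n) at_top sequentially"
    and "\<mu>s 0 = \<mu>"
    and "\<And>n. is_arg_min
           (\<lambda>\<rho>. 1 / 2 * (wasserstein 2 \<rho> (\<mu>s n))\<^sup>2 + lam n * wasserstein 1 \<rho> \<nu>)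
           (\<lambda>\<rho>. \<rho> \<in> prob_measures_on \<Omega>)
           (\<mu>s (Suc n))"
  shows "(\<lambda>n. wasserstein 1 (\<mu>s n) \<nu>) \<longlonglongrightarrow> 0"
proof -
  obtain K where K: "\<And>x y. x \<in> \<Omega> \<Longrightarrow> y \<in> \<Omega> \<Longrightarrow> dist x y \<le> K"
    using compact_imp_bounded[OF assms(2)] unfolding bounded_two_points by blast
  define D where "D = max K 1"
  have D: "dist x y \<le> D" if "x \<in> \<Omega>" "y \<in> \<Omega>" for x y
    using K[OF that] by (simp add: D_def)
  have "D > 0" by (simp add: D_def)
  have closed: "closed \<Omega>"
    using assms(2) by (rule compact_imp_closed)
  have on_\<Omega>: "\<mu>s n \<in> prob_measures_on \<Omega>" for n
    using assms(4,10) assms(11)[of "n - 1"] by (cases n) (auto simp: is_arg_min_def)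
  have not_summable: "\<not> summable (\<lambda>n. min (lam n / D) 1 / 2)"
  proof
    assume "summable (\<lambda>n. min (lam n / D) 1 / 2)"
    then have "summable (\<lambda>n. min (lam n / D) 1)"
      by simp
    then have "summable (\<lambda>n. lam n / D)"
      by (rule summable_of_summable_min) simp
    then have "summable lam"
      using \<open>D > 0\<close> by simp
    then show False
      using not_tendsto_and_filterlim_at_infinity[OF sequentially_bot summable_LIMSEQ]
        filterlim_at_top_imp_at_infinity[OF assms(9)] by blast
  qed
  show ?thesis
  proof (rule contraction_tendsto_zero[OF wasserstein_nonneg _ _ not_summable])
    show "0 \<le> min (lam n / D) 1 / 2" for n
      using assms(8)[of n] \<open>D > 0\<close> by simp
    show "wasserstein 1 (\<mu>s (Suc n)) \<nu> \<le> (1 - min (lam n / D) 1 / 2) * wasserstein 1 (\<mu>s n) \<nu>" for n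
      by (rule proximal_step_contraction[OF assms(1) closed D \<open>D > 0\<close> on_\<Omega> assms(5) assms(8) assms(11)])
  qed
qed

end
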